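(* Let $K$ be a finite simplicial complex and let $f:K\to\mathbb{R}$ be a discrete Morse function. If $(\mathcal{H},\mathcal{S})$ is a collection of min-max data for $f$ on $K$, then the number $$c=\min_{S\in\mathcal{S}}\ \max_{\sigma\in S} f(\sigma)$$ is a critical value for $f$.
   Context: $K$ is identified with its set of simplices; $\alpha^{(p)}$ denotes a simplex of dimension $p$, and $\alpha<\beta$ means that $\alpha$ is a face of $\beta$. For $f:K\to\mathbb{R}$ and $\alpha^{(p)}\in K$ put $U(\alpha)=\{\beta^{(p+1)}>\alpha : f(\beta)\le f(\alpha)\}$ and $L(\alpha)=\{\gamma^{(p-1)}<\alpha : f(\gamma)\ge f(\alpha)\}$. The function $f$ is a discrete Morse function if $|U(\alpha)|\le 1$ and $|L(\alpha)|\le 1$ for every $\alpha\in K$. A simplex $\alpha$ is critical if $|U(\alpha)|=0$ and $|L(\alpha)|=0$. A critical value of $f$ is its value at a critical simplex; a regular value is a real number that is not a critical value. For $a\in\mathbb{R}$ the sublevel set is $L^a=\{\sigma\in K: f(\sigma)\le a\}$. Let $\mathcal{P}(K)$ be the power set of $K$. A collection of min-max data for the discrete Morse function $f$ is a pair $(\mathcal{H},\mathcal{S})$ satisfying the following conditions. (1) $\mathcal{H}$ is a collection of maps $\mathcal{P}(K)\to\mathcal{P}(K)$ such that for every regular value $a$ of $f$ there exist $\varepsilon>0$ and $h\in\mathcal{H}$ such that $h(L^{a+\varepsilon})\subset L^{a-\varepsilon}$. (2) $\mathcal{S}$ is a collection of subsets of $K$ such that for all $h\in\mathcal{H}$ and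 all $S\in\mathcal{S}$, $h(S)\in\mathcal{S}$.
   Formalization: The maps h in H are additionally assumed to preserve inclusions (A ⊂ B implies h(A) ⊂ h(B)), since the claim fails for arbitrary maps of P(K); S is assumed nonempty with nonempty members so that the min and max exist. *)

theory Defs
  imports Complex_Main "HOL-Library.FuncSet"
begin

text \<open>
  Abstract simplicial complexes, given by their set of simplices. Simplices are nonempty finite
  vertex sets; in particular the empty set is not a simplex, unlike in the geometric
  simplicial complexes of HOL-Analysis.
\<close>

definition simplicial_complex :: "'a set set \<Rightarrow> bool" where
  "simplicial_complex K \<longleftrightarrow>
     (\<forall>\<sigma>\<in>K. finite \<sigma> \<and> \<sigma> \<noteq> {}) \<and> (\<forall>\<sigma>\<in>K. \<forall>\<tau>. \<tau> \<noteq> {} \<and> \<tau> \<subseteq> \<sigma> \<longrightarrow> \<tau> \<in> K)"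

definition simplex_dim :: "'a set \<Rightarrow> nat" where
  "simplex_dim \<sigma> = card \<sigma> - 1"

text \<open>
  Functions on \<open>K\<close> are total functions of which only the values on \<open>K\<close> matter.
\<close>

definition Up :: "'a set set \<Rightarrow> ('a set \<Rightarrow> real) \<Rightarrow> 'a set \<Rightarrow> 'a set set" where
  "Up K f \<alpha> = {\<beta>\<in>K. \<alpha> \<subset> \<beta> \<and> simplex_dim \<beta> = simplex_dim \<alpha> + 1 \<and> f \<beta> \<le> f \<alpha>}"

definition Low :: "'a set set \<Rightarrow> ('a set \<Rightarrow> real) \<Rightarrow> 'a set \<Rightarrow> 'a set set" where
  "Low K f \<alpha> = {\<gamma>\<in>K. \<gamma> \<subset> \<alpha> \<and> simplex_dim \<alpha> = simplex_dim \<gamma> + 1 \<and> f \<gamma> \<ge> f \<alpha>}"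

definition discrete_Morse :: "'a set set \<Rightarrow> ('a set \<Rightarrow> real) \<Rightarrow> bool" where
  "discrete_Morse K f \<longleftrightarrow> (\<forall>\<alpha>\<in>K. card (Up K f \<alpha>) \<le> 1 \<and> card (Low K f \<alpha>) \<le> 1)"

definition critical_simplex :: "'a set set \<Rightarrow> ('a set \<Rightarrow> real) \<Rightarrow> 'a set \<Rightarrow> bool" where
  "critical_simplex K f \<alpha> \<longleftrightarrow> \<alpha> \<in> K \<and> card (Up K f \<alpha>) = 0 \<and> card (Low K f \<alpha>) = 0"

definition critical_value :: "'a set set \<Rightarrow> ('a set \<Rightarrow> real) \<Rightarrow> real \<Rightarrow> bool" where
  "critical_value K f c \<longleftrightarrow> (\<exists>\<alpha>. critical_simplex K f \<alpha> \<and> f \<alpha> = c)"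

definition regular_value :: "'a set set \<Rightarrow> ('a set \<Rightarrow> real) \<Rightarrow> real \<Rightarrow> bool" where
  "regular_value K f a \<longleftrightarrow> \<not> critical_value K f a"

definition sublevel :: "'a set set \<Rightarrow> ('a set \<Rightarrow> real) \<Rightarrow> real \<Rightarrow> 'a set set" where
  "sublevel K f a = {\<sigma>\<in>K. f \<sigma> \<le> a}"

text \<open>
  The maps \<open>h\<close> act on whole collections of simplices and need not be induced by maps of
  simplices. In particular \<open>S \<subseteq> T\<close> does not imply \<open>h S \<subseteq> h T\<close>; where inclusions have to be
  preserved, this is a separate hypothesis.
\<close>

definition min_max_data ::
  "'a set set \<Rightarrow> ('a set \<Rightarrow> real) \<Rightarrow> ('a set set \<Rightarrow> 'a set set) set \<Rightarrow> 'a set set set \<Rightarrow> bool" where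
  "min_max_data K f \<H> \<S> \<longleftrightarrow>
     \<H> \<subseteq> (Pow K \<rightarrow> Pow K) \<and>
     (\<forall>a. regular_value K f a \<longrightarrow>
        (\<exists>\<epsilon>>0. \<exists>h\<in>\<H>. h (sublevel K f (a + \<epsilon>)) \<subseteq> sublevel K f (a - \<epsilon>))) \<and>
     \<S> \<subseteq> Pow K \<and>
     (\<forall>h\<in>\<H>. \<forall>S\<in>\<S>. h S \<in> \<S>)"

end

theory Submission imports Defs begin

text \<open>
  Suppose that the min-max value \<open>c\<close> were regular. The data then provide a map \<open>h\<close> that pushes the
  sublevel set at height \<open>c + \<epsilon>\<close> below height \<open>c - \<epsilon>\<close>. A member \<open>S\<close> of the family whose maximum
  is \<open>c\<close> lies in the former set, so monotonicity of \<open>h\<close> puts \<open>h S\<close> below \<open>c - \<epsilon>\<close>. But \<open>h S\<close>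
  belongs to the family again, so its maximum cannot drop below the minimum \<open>c\<close>.
\<close>

theorem theorem3p2:
  fixes K :: "'a set set" and f :: "'a set \<Rightarrow> real"
    and \<H> :: "('a set set \<Rightarrow> 'a set set) set" and \<S> :: "'a set set set"
  assumes "simplicial_complex K" and "finite K"
    and "discrete_Morse K f"
    and "min_max_data K f \<H> \<S>"
    and "\<forall>h\<in>\<H>. mono_on (Pow K) h"
    and "\<S> \<noteq> {}" and "{} \<notin> \<S>"
  shows "critical_value K f (Min ((\<lambda>S. Max (f ` S)) ` \<S>))"
proof (rule ccontr)
  define c where "c = Min ((\<lambda>S. Max (f ` S)) ` \<S>)"
  assume "\<not> critical_value K f (Min ((\<lambda>S. Max (f ` S)) ` \<S>))"
  then have "regular_value K f c"
    by (simp add: c_def regular_value_def)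
  then obtain \<epsilon> h where "\<epsilon> > 0" and h: "h \<in> \<H>"
    and push: "h (sublevel K f (c + \<epsilon>)) \<subseteq> sublevel K f (c - \<epsilon>)"
    using assms(4) unfolding min_max_data_def by metis
  have family: "\<S> \<subseteq> Pow K" and stable: "\<And>S. S \<in> \<S> \<Longrightarrow> h S \<in> \<S>"
    using assms(4) h unfolding min_max_data_def by simp_all
  have fin_family: "finite \<S>"
    using family assms(2) by (simp add: finite_subset)
  have fin: "finite S" if "S \<in> \<S>" for S
    using that family assms(2) by (meson PowD finite_subset subsetD)
  have "c \<in> (\<lambda>S. Max (f ` S)) ` \<S>"
    unfolding c_def using fin_family assms(6) by (intro Min_in) auto
  then obtain S where S: "S \<in> \<S>" and Max_S: "c = Max (f ` S)"
    by blast
  have "S \<subseteq> sublevel K f (c + \<epsilon>)"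
  proof
    fix \<sigma> assume \<sigma>: "\<sigma> \<in> S"
    then have "f \<sigma> \<le> c"
      unfolding Max_S using fin[OF S] by (intro Max_ge) auto
    then show "\<sigma> \<in> sublevel K f (c + \<epsilon>)"
      using \<sigma> S family \<open>\<epsilon> > 0\<close> by (auto simp: sublevel_def)
  qed
  moreover have "S \<in> Pow K" "sublevel K f (c + \<epsilon>) \<in> Pow K"
    using S family by (auto simp: sublevel_def)
  ultimately have "h S \<subseteq> h (sublevel K f (c + \<epsilon>))"
    using assms(5) h by (meson mono_onD)
  then have below: "h S \<subseteq> sublevel K f (c - \<epsilon>)"
    using push by simp
  have hS: "h S \<in> \<S>"
    using S by (rule stable)
  then have "h S \<noteq> {}"
    using assms(7) by metis
  then have "Max (f ` h S) \<le> c - \<epsilon>"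
    using fin[OF hS] below by (subst Max_le_iff) (auto simp: sublevel_def)
  moreover have "c \<le> Max (f ` h S)"
    unfolding c_def using fin_family hS by (intro Min_le) auto
  ultimately show False
    using \<open>\<epsilon> > 0\<close> by simp
qed

end
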